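(* Let $p\ge1$ and let $\{\psi_j:j\in\mathbb Z\}\subset\mathbb R$ with $\psi_j=0$ for $j<0$ and $\sum_{j=0}^\infty|\psi_j|<\infty$. Then $$\mathcal W_n(p)=O(n^{1/p})\quad\text{as } n\to\infty.$$
   Context: For $n\ge1$ and $j\in\mathbb Z$, $w_{nj}=\sum_{k=1}^n\psi_{k-j}$ (with the convention $\psi_i=0$ for $i<0$), and for $p\ge1$, $$\mathcal W_n(p)=\Bigl(\sum_{j=-\infty}^n|w_{nj}|^p\Bigr)^{1/p}.$$ *)

theory Defs
  imports "HOL-Analysis.Infinite_Sum" "HOL-Library.Landau_Symbols"
begin

definition w :: "(int \<Rightarrow> real) \<Rightarrow> nat \<Rightarrow> int \<Rightarrow> real" where
  "w \<psi> n j = (\<Sum>k=1..n. \<psi> (int k - j))"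

text \<open>
  \<open>infsum\<close> is \<open>0\<close> on families that are not summable, so \<open>W\<close> is the intended quantity only
  when the \<open>p\<close>-th powers are summable; statements about the size of \<open>W\<close> therefore have to assert
  this summability separately.
\<close>

definition W :: "(int \<Rightarrow> real) \<Rightarrow> nat \<Rightarrow> real \<Rightarrow> real" where
  "W \<psi> n p = (\<Sum>\<^sub>\<infinity>j\<in>{..int n}. \<bar>w \<psi> n j\<bar> powr p) powr (1 / p)"

end

theory Submission
  imports Defs
begin

text \<open>
  Put \<open>A = \<Sum>\<bar>\<psi> j\<bar>\<close>. The row \<open>w \<psi> n\<close> is a sum of \<open>n\<close> translates of the reflection of \<open>\<psi>\<close>, which
  gives two estimates: its supremum norm is at most \<open>A\<close> (the \<open>n\<close> arguments \<open>k - j\<close> are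
  distinct), and its \<open>\<ell>\<^sup>1\<close> norm is at most \<open>n * A\<close> (each translate has \<open>\<ell>\<^sup>1\<close> norm \<open>A\<close>).
  Interpolating between them,
  \<open>\<bar>w \<psi> n j\<bar> powr p \<le> A powr (p - 1) * \<bar>w \<psi> n j\<bar>\<close>, so the \<open>p\<close>-th powers are summable with sum at
  most \<open>n * A powr p\<close>, and taking \<open>p\<close>-th roots yields \<open>W \<psi> n p \<le> A * n powr (1 / p)\<close>.
\<close>

lemma abs_summable_on_int_if_causal:
  fixes \<psi> :: "int \<Rightarrow> real"
  assumes "\<And>j. j < 0 \<Longrightarrow> \<psi> j = 0"
    and "summable (\<lambda>j::nat. \<bar>\<psi> (int j)\<bar>)"
  shows "(\<lambda>j. \<bar>\<psi> j\<bar>) summable_on UNIV"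
proof -
  have "(\<lambda>j::nat. \<bar>\<psi> (int j)\<bar>) summable_on UNIV"
    using assms(2) by (intro norm_summable_imp_summable_on) simp
  then have "(\<lambda>j. \<bar>\<psi> j\<bar>) summable_on range int"
    by (subst summable_on_reindex) (auto simp: o_def)
  moreover have "\<psi> j = 0" if "j \<notin> range int" for j
    using that assms(1)[of j] by (metis nonneg_int_cases not_less rangeI)
  ultimately show ?thesis
    by (subst summable_on_cong_neutral[where T = "range int" and g = "\<lambda>j. \<bar>\<psi> j\<bar>"]) auto
qed

lemma has_sum_reflect_shift:
  fixes f :: "int \<Rightarrow> real"
  assumes "(f has_sum A) UNIV"
  shows "((\<lambda>j. f (k - j)) has_sum A) UNIV"
proof -
  have "bij (\<lambda>j. k - j)"
    by (rule o_bij[where g = "\<lambda>j. k - j"]) auto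
  from has_sum_reindex_bij_betw[OF this, of f A] assms show ?thesis by simp
qed

lemma has_sum_sum_family:
  fixes f :: "'i \<Rightarrow> 'a \<Rightarrow> real"
  assumes "\<And>i. i \<in> I \<Longrightarrow> (f i has_sum s i) S"
  shows "((\<lambda>x. \<Sum>i\<in>I. f i x) has_sum (\<Sum>i\<in>I. s i)) S"
  using assms by (induction I rule: infinite_finite_induct) (auto intro!: has_sum_add)

lemma abs_w_le_sum: "\<bar>w \<psi> n j\<bar> \<le> (\<Sum>k=1..n. \<bar>\<psi> (int k - j)\<bar>)"
  unfolding w_def by (rule sum_abs)

text \<open>
  The integers \<open>k - j\<close> for \<open>1 \<le> k \<le> n\<close> are distinct, so the defining sum sees each entry of
  \<open>\<psi>\<close> at most once.
\<close>

lemma abs_w_le_infsum: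
  assumes "(\<lambda>j. \<bar>\<psi> j\<bar>) summable_on UNIV"
  shows "\<bar>w \<psi> n j\<bar> \<le> (\<Sum>\<^sub>\<infinity>i. \<bar>\<psi> i\<bar>)"
proof -
  have "inj_on (\<lambda>k. int k - j) {1..n}"
    by (auto simp: inj_on_def)
  then have "(\<Sum>k=1..n. \<bar>\<psi> (int k - j)\<bar>) = (\<Sum>i\<in>(\<lambda>k. int k - j) ` {1..n}. \<bar>\<psi> i\<bar>)"
    by (simp add: sum.reindex)
  also have "\<dots> \<le> (\<Sum>\<^sub>\<infinity>i. \<bar>\<psi> i\<bar>)"
    by (rule finite_sum_le_infsum[OF assms]) auto
  finally show ?thesis
    using abs_w_le_sum[of \<psi> n j] by linarith
qed

lemma powr_le_powr_minus_one_mult: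
  fixes x A p :: real
  assumes "0 \<le> x" "x \<le> A" "1 \<le> p"
  shows "x powr p \<le> A powr (p - 1) * x"
proof -
  have "x powr p = x powr (p - 1) * x"
    using powr_mult_base[OF assms(1), of "p - 1"] by (simp add: mult.commute)
  also have "\<dots> \<le> A powr (p - 1) * x"
    using assms by (intro mult_right_mono powr_mono2) auto
  finally show ?thesis .
qed

text \<open>
  The majorant replaces \<open>\<bar>w \<psi> n j\<bar>\<close> by the sum of the absolute values of its terms, because the
  total of that sum over all \<open>j\<close> is known exactly: \<open>n\<close> translates, each of total \<open>A\<close>.
\<close>

lemma w_powr_summable_and_bound:
  fixes \<psi> :: "int \<Rightarrow> real"
  assumes "(\<lambda>j. \<bar>\<psi> j\<bar>) summable_on UNIV" and "p \<ge> 1"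
  defines "A \<equiv> \<Sum>\<^sub>\<infinity>j. \<bar>\<psi> j\<bar>"
  shows "(\<lambda>j. \<bar>w \<psi> n j\<bar> powr p) summable_on S"
    and "(\<Sum>\<^sub>\<infinity>j\<in>S. \<bar>w \<psi> n j\<bar> powr p) \<le> real n * A powr p"
proof -
  define g where "g j = A powr (p - 1) * (\<Sum>k=1..n. \<bar>\<psi> (int k - j)\<bar>)" for j
  have "A \<ge> 0"
    unfolding A_def by (rule infsum_nonneg) simp
  have le: "\<bar>w \<psi> n j\<bar> powr p \<le> g j" for j
  proof -
    have "\<bar>w \<psi> n j\<bar> powr p \<le> A powr (p - 1) * \<bar>w \<psi> n j\<bar>"
      unfolding A_def
      by (rule powr_le_powr_minus_one_mult[OF _ abs_w_le_infsum[OF assms(1)] assms(2)]) simp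
    also have "\<dots> \<le> g j"
      unfolding g_def by (intro mult_left_mono abs_w_le_sum) simp
    finally show ?thesis .
  qed
  have "((\<lambda>j. \<bar>\<psi> j\<bar>) has_sum A) UNIV"
    unfolding A_def using assms(1) by (rule has_sum_infsum)
  then have "((\<lambda>j. \<Sum>k=1..n. \<bar>\<psi> (int k - j)\<bar>) has_sum (\<Sum>k=1..n. A)) UNIV"
    by (intro has_sum_sum_family has_sum_reflect_shift)
  then have "(g has_sum A powr (p - 1) * (\<Sum>k=1..n. A)) UNIV"
    unfolding g_def by (rule has_sum_cmult_right)
  moreover have "A powr (p - 1) * (\<Sum>k=1..n. A) = real n * A powr p"
    using powr_mult_base[OF \<open>A \<ge> 0\<close>, of "p - 1"] by (simp add: algebra_simps)
  ultimately have g: "(g has_sum real n * A powr p) UNIV"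
    by metis
  then have "g summable_on UNIV"
    by (rule has_sum_imp_summable)
  then have summable: "(\<lambda>j. \<bar>w \<psi> n j\<bar> powr p) summable_on T" for T
    by (rule summable_on_subset_banach[OF summable_on_comparison_test[OF _ le]]) auto
  then show "(\<lambda>j. \<bar>w \<psi> n j\<bar> powr p) summable_on S" .
  have "(\<Sum>\<^sub>\<infinity>j\<in>S. \<bar>w \<psi> n j\<bar> powr p) \<le> (\<Sum>\<^sub>\<infinity>j. \<bar>w \<psi> n j\<bar> powr p)"
    by (rule infsum_mono_neutral[OF summable summable]) auto
  also have "\<dots> \<le> real n * A powr p"
    using has_sum_mono[OF has_sum_infsum[OF summable] g le] .
  finally show "(\<Sum>\<^sub>\<infinity>j\<in>S. \<bar>w \<psi> n j\<bar> powr p) \<le> real n * A powr p" .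
qed

lemma W_le:
  fixes \<psi> :: "int \<Rightarrow> real"
  assumes "(\<lambda>j. \<bar>\<psi> j\<bar>) summable_on UNIV" and "p \<ge> 1"
  shows "W \<psi> n p \<le> (\<Sum>\<^sub>\<infinity>j. \<bar>\<psi> j\<bar>) * real n powr (1 / p)"
proof -
  define A where "A = (\<Sum>\<^sub>\<infinity>j. \<bar>\<psi> j\<bar>)"
  have "A \<ge> 0"
    unfolding A_def by (rule infsum_nonneg) simp
  have "W \<psi> n p \<le> (real n * A powr p) powr (1 / p)"
    unfolding W_def A_def using assms(2) w_powr_summable_and_bound(2)[OF assms]
    by (intro powr_mono2) (auto intro: infsum_nonneg)
  also have "\<dots> = A * real n powr (1 / p)"
    using \<open>A \<ge> 0\<close> assms(2) by (simp add: powr_mult powr_powr)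
  finally show ?thesis
    unfolding A_def .
qed

theorem proposition4:
  fixes p :: real and \<psi> :: "int \<Rightarrow> real"
  assumes "p \<ge> 1"
    and "\<And>j. j < 0 \<Longrightarrow> \<psi> j = 0"
    and "summable (\<lambda>j::nat. \<bar>\<psi> (int j)\<bar>)"
  shows "(\<forall>n\<ge>1. (\<lambda>j. \<bar>w \<psi> n j\<bar> powr p) summable_on {..int n}) \<and>
         (\<lambda>n. W \<psi> n p) \<in> O(\<lambda>n. real n powr (1 / p))"
proof -
  note abs_summable = abs_summable_on_int_if_causal[OF assms(2,3)]
  have "norm (W \<psi> n p) \<le> (\<Sum>\<^sub>\<infinity>j. \<bar>\<psi> j\<bar>) * norm (real n powr (1 / p))" for n
    using W_le[OF abs_summable assms(1), of n] by (simp add: W_def)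
  then have "(\<lambda>n. W \<psi> n p) \<in> O(\<lambda>n. real n powr (1 / p))"
    by (intro bigoI always_eventually allI)
  with w_powr_summable_and_bound(1)[OF abs_summable assms(1)] show ?thesis
    by blast
qed

end
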